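(* Let $u,v\in S_n$ and $i\in[n-1]$. The following are equivalent: (1) there exists $\mathbf{a}\in[n]^n$ such that $u\lesssim_{\mathbf{a}}v$ and $i\in\mathrm{Des}_{\mathbf{a}}(v)\cap\mathrm{Asc}_{\mathbf{a}}(u)$; (2) there exists $\mathbf{a}\in[n]^n$ such that $u\lesssim_{\mathbf{a}}v$, $a_i=a_{i+1}$, and $us_i,vs_i\in[u,v]$; (3) the tilted Bruhat interval $[u,v]$ is invariant under right multiplication by $s_i$, i.e. $[u,v]=\{ws_i:w\in[u,v]\}$.
   Context: Permutations are in one-line notation $w=w_1\cdots w_n$, $w[k]:=\{w_1,\dots,w_k\}$; $wt_{ij}$ (resp. $ws_i$) swaps the entries of $w$ in positions $i<j$ (resp. $i,i+1$); $\ell(w)$ is the number of inversions. Quantum Bruhat graph $\Gamma_n$: directed graph on $S_n$ with an edge $w\to wt_{ij}$ ($i<j$) whenever $\ell(wt_{ij})=\ell(w)+1$ or $\ell(wt_{ij})=\ell(w)+1-2(j-i)$; $\ell(x,y)$ is the length of a shortest directed path from $x$ to $y$. Tilted Bruhat interval: $[u,v]:=\{w:\ell(u,w)+\ell(w,v)=\ell(u,v)\}$. Cyclic interval $[a,b)_c$: $\{a,\dots,b-1\}$ if $a\le b$, $\{a,\dots,n\}\cup\{1,\dots,b-1\}$ if $a>b$. For $r\in[n]$, $<_r$ is the total order $r<_r r+1<_r\cdots<_r n<_r1<_r\cdots<_r r-1$; for $k$-subsets $A=\{a_1<_r\cdots<_r a_k\}$, $B=\{b_1<_r\cdots<_r b_k\}$,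 $A\le_r B$ means $a_i\le_r b_i$ for all $i$. For $\mathbf{a}\in[n]^n$: $u\lesssim_{\mathbf{a}}v$ iff $u[k]\le_{a_k}v[k]$ for all $k\in[n]$ and $|u[k]\cap[a_k,a_{k+1})_c|=|v[k]\cap[a_k,a_{k+1})_c|$ for all $k\in[n-1]$. $\mathrm{Des}_{\mathbf{a}}(w):=\{i:a_i=a_{i+1},\ w_i>_{a_i}w_{i+1}\}$, $\mathrm{Asc}_{\mathbf{a}}(w):=\{i:a_i=a_{i+1},\ w_i<_{a_i}w_{i+1}\}$. *)

theory Defs
  imports "HOL-Combinatorics.Permutations" "HOL-Library.FuncSet"
begin

text \<open>
  The symmetric group \<open>S_n\<close> is the set of all \<open>w :: nat \<Rightarrow> nat\<close> with \<open>w permutes {1..n}\<close>;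
  the one-line notation of \<open>w\<close> is \<open>w 1, \<dots>, w n\<close>, so that swapping the entries in the positions
  \<open>i\<close> and \<open>j\<close> is the right multiplication \<open>w \<circ> transpose i j\<close>.
\<close>

definition perm_length :: "nat \<Rightarrow> (nat \<Rightarrow> nat) \<Rightarrow> nat" where
  "perm_length n w = card {(i, j). i \<in> {1..n} \<and> j \<in> {1..n} \<and> i < j \<and> w j < w i}"

definition quantum_bruhat_graph :: "nat \<Rightarrow> ((nat \<Rightarrow> nat) \<times> (nat \<Rightarrow> nat)) set" where
  "quantum_bruhat_graph n =
     {(w, w \<circ> transpose i j) | w i j.
        w permutes {1..n} \<and> i \<in> {1..n} \<and> j \<in> {1..n} \<and> i < j \<and>
        (int (perm_length n (w \<circ> transpose i j)) = int (perm_length n w) + 1 \<or>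
         int (perm_length n (w \<circ> transpose i j))
           = int (perm_length n w) + 1 - 2 * (int j - int i))}"

text \<open>
  The quantum Bruhat graph is strongly connected (an adjacent transposition changes the length
  by \<open>1\<close> or \<open>-1\<close>, so it always gives an edge), hence the minimum below is over a nonempty set for
  all permutations \<open>x\<close> and \<open>y\<close>.
\<close>

definition qb_dist :: "nat \<Rightarrow> (nat \<Rightarrow> nat) \<Rightarrow> (nat \<Rightarrow> nat) \<Rightarrow> nat" where
  "qb_dist n x y = (LEAST d. (x, y) \<in> quantum_bruhat_graph n ^^ d)"

definition tilted_interval :: "nat \<Rightarrow> (nat \<Rightarrow> nat) \<Rightarrow> (nat \<Rightarrow> nat) \<Rightarrow> (nat \<Rightarrow> nat) set" where
  "tilted_interval n u v =
     {w. w permutes {1..n} \<and> qb_dist n u w + qb_dist n w v = qb_dist n u v}"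

definition cyclic_interval :: "nat \<Rightarrow> nat \<Rightarrow> nat \<Rightarrow> nat set" where
  "cyclic_interval n a b = (if a \<le> b then {a..<b} else {a..n} \<union> {1..<b})"

text \<open>
  On \<open>{1..n}\<close> with \<open>r \<in> {1..n}\<close>, this is the order \<open>r < r + 1 < \<dots> < n < 1 < \<dots> < r - 1\<close>: both
  blocks \<open>{r..n}\<close> and \<open>{1..<r}\<close> carry the usual order, and the first block precedes the second.
\<close>

definition rot_less :: "nat \<Rightarrow> nat \<Rightarrow> nat \<Rightarrow> bool" where
  "rot_less r x y \<longleftrightarrow> (r \<le> x \<and> x < y) \<or> (x < y \<and> y < r) \<or> (r \<le> x \<and> y < r)"

definition rot_le :: "nat \<Rightarrow> nat \<Rightarrow> nat \<Rightarrow> bool" where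
  "rot_le r x y \<longleftrightarrow> rot_less r x y \<or> x = y"

text \<open>
  \<open>xs\<close> and \<open>ys\<close> are the (unique) increasing enumerations of the finite sets \<open>A\<close> and \<open>B\<close>.
\<close>

definition rot_set_le :: "nat \<Rightarrow> nat set \<Rightarrow> nat set \<Rightarrow> bool" where
  "rot_set_le r A B \<longleftrightarrow>
     (\<exists>xs ys. set xs = A \<and> sorted_wrt (rot_less r) xs \<and>
              set ys = B \<and> sorted_wrt (rot_less r) ys \<and>
              list_all2 (rot_le r) xs ys)"

text \<open>
  The set \<open>w[k]\<close> of the first \<open>k\<close> entries of \<open>w\<close> is the image \<open>w ` {1..k}\<close>.
\<close>

definition tilted_le :: "nat \<Rightarrow> (nat \<Rightarrow> nat) \<Rightarrow> (nat \<Rightarrow> nat) \<Rightarrow> (nat \<Rightarrow> nat) \<Rightarrow> bool" where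
  "tilted_le n a u v \<longleftrightarrow>
     (\<forall>k\<in>{1..n}. rot_set_le (a k) (u ` {1..k}) (v ` {1..k})) \<and>
     (\<forall>k\<in>{1..n-1}. card (u ` {1..k} \<inter> cyclic_interval n (a k) (a (k + 1)))
                  = card (v ` {1..k} \<inter> cyclic_interval n (a k) (a (k + 1))))"

definition Des :: "nat \<Rightarrow> (nat \<Rightarrow> nat) \<Rightarrow> (nat \<Rightarrow> nat) \<Rightarrow> nat set" where
  "Des n a w = {i \<in> {1..n-1}. a i = a (i + 1) \<and> rot_less (a i) (w (i + 1)) (w i)}"

definition Asc :: "nat \<Rightarrow> (nat \<Rightarrow> nat) \<Rightarrow> (nat \<Rightarrow> nat) \<Rightarrow> nat set" where
  "Asc n a w = {i \<in> {1..n-1}. a i = a (i + 1) \<and> rot_less (a i) (w i) (w (i + 1))}"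

end

theory Submission
  imports Defs
begin

text \<open>
  Along a path in the quantum Bruhat graph every step moves an element of each prefix set upwards
  in the cyclic order on \<open>{1..n}\<close>, and the down steps are those that wrap around from \<open>n\<close> to \<open>1\<close>.
  The number of crossings of any other cut between \<open>r - 1\<close> and \<open>r\<close> is nonnegative and differs from
  the number of wraps by a quantity depending only on the end points. This gives a lower bound for
  the number of wraps in position \<open>k\<close> (\<open>winding\<close>), hence for the length of a path, and a greedy
  choice of edges attains it. The cuts crossed the least are exactly the \<open>r\<close> with
  \<open>u[k] \<le>\<^sub>r v[k]\<close>, so \<open>u \<lesssim>\<^sub>a v\<close> says that both \<open>a\<^sub>k\<close> and \<open>a\<^sub>k\<^sub>+\<^sub>1\<close> are
  optimal for \<open>k\<close>, and membership of \<open>w\<close> in \<open>[u, v]\<close> means that cuts optimal for \<open>(u, v)\<close> stay optimal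
  for \<open>(u, w)\<close> and \<open>(w, v)\<close>. From (1) to (3) the usual lifting property applies with respect to \<open><\<^sub>r\<close>, where
  \<open>r = a\<^sub>i = a\<^sub>i\<^sub>+\<^sub>1\<close>. From (3) to (2), take \<open>p\<close> optimal for \<open>i - 1\<close> and \<open>i\<close>, and \<open>q\<close> optimal for
  \<open>i\<close> and \<open>i + 1\<close>: invariance forces \<open>w\<^sub>i\<close> and \<open>w\<^sub>i\<^sub>+\<^sub>1\<close> to lie on the same side of the pair of cuts \<open>p, q\<close>
  for all \<open>w \<in> [u, v]\<close>, so this side is constant along a geodesic, and \<open>q\<close> is optimal for \<open>i - 1\<close> too.
\<close>

section \<open>Tail counts, windings and optimal cuts\<close>

definition tail_count :: "(nat \<Rightarrow> nat) \<Rightarrow> nat \<Rightarrow> nat \<Rightarrow> int" where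
  "tail_count w k s = (\<Sum>m=1..k. of_bool (s \<le> w m))"

text \<open>The cut \<open>s = 0\<close> is equivalent to \<open>s = 1\<close>; it keeps the maximum over a nonempty set when \<open>n = 0\<close>.\<close>

definition winding :: "nat \<Rightarrow> (nat \<Rightarrow> nat) \<Rightarrow> (nat \<Rightarrow> nat) \<Rightarrow> nat \<Rightarrow> int" where
  "winding n u v k = Max ((\<lambda>s. tail_count u k s - tail_count v k s) ` {0..n})"

text \<open>Along a path, \<open>tail_count v k s - tail_count u k s\<close> is the number of
  crossings of the cut \<open>s\<close> minus the number of wraps, so its minimisers are the cuts
  crossed least.\<close>

definition optimal_cut :: "nat \<Rightarrow> (nat \<Rightarrow> nat) \<Rightarrow> (nat \<Rightarrow> nat) \<Rightarrow> nat \<Rightarrow> nat \<Rightarrow> bool" where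
  "optimal_cut n u v k r \<longleftrightarrow> r \<in> {1..n} \<and>
     (\<forall>s\<in>{1..n}. tail_count v k r - tail_count u k r \<le> tail_count v k s - tail_count u k s)"

text \<open>An up edge adds 1 to the length; a down edge swapping \<open>i < j\<close> adds
  \<open>1 - 2 * (j - i)\<close> and wraps once in each prefix \<open>k\<close> with
  \<open>i \<le> k < j\<close>. So a path has as many steps as the length difference plus twice its
  wraps; here the wraps are replaced by their lower bounds.\<close>

definition tilted_length :: "nat \<Rightarrow> (nat \<Rightarrow> nat) \<Rightarrow> (nat \<Rightarrow> nat) \<Rightarrow> int" where
  "tilted_length n u v = int (perm_length n v) - int (perm_length n u) + 2 * (\<Sum>k=1..n. winding n u v k)"

lemma tail_count_0 [simp]: "tail_count w 0 s = 0"
  by (simp add: tail_count_def)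

lemma tail_count_Suc [simp]: "tail_count w (Suc k) s = tail_count w k s + of_bool (s \<le> w (Suc k))"
  by (simp add: tail_count_def)

lemma tail_count_transpose:
  assumes "1 \<le> i" "i < j"
  shows "tail_count (w \<circ> transpose i j) k s =
    tail_count w k s + (if i \<le> k \<and> k < j then of_bool (s \<le> w j) - of_bool (s \<le> w i) else 0)"
proof (induction k)
  case (Suc k)
  consider "Suc k < j" | "Suc k = j" | "j < Suc k" by linarith
  then show ?case
    using Suc assms by cases (auto simp: transpose_def le_Suc_eq)
qed (use assms in simp)

lemma tail_count_outside:
  assumes "w permutes {1..n}" "k \<le> n" "s \<le> 1 \<or> n < s"
  shows "tail_count w k s = (if s \<le> 1 then int k else 0)"
  using assms(2)
proof (induction k)
  case (Suc k)
  have "w (Suc k) \<in> {1..n}"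
    using permutes_in_image[OF assms(1), of "Suc k"] Suc.prems by simp
  then show ?case
    using Suc assms(3) by auto
qed simp

lemma tail_count_diff_le_winding:
  assumes "u permutes {1..n}" "v permutes {1..n}" "k \<le> n"
  shows "tail_count u k s - tail_count v k s \<le> winding n u v k"
proof -
  have *: "tail_count u k t - tail_count v k t \<le> winding n u v k" if "t \<le> n" for t
    unfolding winding_def by (rule Max_ge) (use that in auto)
  show ?thesis
  proof (cases "s \<le> n")
    case False
    then have "tail_count u k s - tail_count v k s = tail_count u k 0 - tail_count v k 0"
      using assms by (simp add: tail_count_outside)
    then show ?thesis using *[of 0] by simp
  qed (use * in blast)
qed

lemma winding_le:
  assumes "\<And>s. tail_count u k s - tail_count v k s \<le> c"
  shows "winding n u v k \<le> c"
  unfolding winding_def using assms by simp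

lemma winding_triangle:
  assumes "u permutes {1..n}" "v permutes {1..n}" "w permutes {1..n}" "k \<le> n"
  shows "winding n u v k \<le> winding n u w k + winding n w v k"
proof (rule winding_le)
  fix s
  show "tail_count u k s - tail_count v k s \<le> winding n u w k + winding n w v k"
    using tail_count_diff_le_winding[of u n w k s] tail_count_diff_le_winding[of w n v k s] assms
    by linarith
qed

lemma optimal_cut_iff_winding:
  assumes "u permutes {1..n}" "v permutes {1..n}" "k \<le> n" "r \<in> {1..n}"
  shows "optimal_cut n u v k r \<longleftrightarrow> tail_count u k r - tail_count v k r = winding n u v k"
proof
  assume opt: "optimal_cut n u v k r"
  have "winding n u v k \<le> tail_count u k r - tail_count v k r"
  proof (rule winding_le)
    fix s
    obtain t where "t \<in> {1..n}" "tail_count u k s - tail_count v k s = tail_count u k t - tail_count v k t"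
    proof (cases "s \<in> {1..n}")
      case False
      then have "tail_count u k s - tail_count v k s = tail_count u k 1 - tail_count v k 1"
        using assms by (auto simp: tail_count_outside)
      then show ?thesis using that[of 1] assms(4) by auto
    qed (use that in blast)
    then show "tail_count u k s - tail_count v k s \<le> tail_count u k r - tail_count v k r"
      using opt unfolding optimal_cut_def by fastforce
  qed
  then show "tail_count u k r - tail_count v k r = winding n u v k"
    using tail_count_diff_le_winding[OF assms(1-3), of r] by linarith
next
  assume "tail_count u k r - tail_count v k r = winding n u v k"
  then show "optimal_cut n u v k r"
    unfolding optimal_cut_def
    using tail_count_diff_le_winding[OF assms(1-3)] assms(4) by (smt (verit))
qed

text \<open>At the cut \<open>r\<close> the difference for \<open>(u, v)\<close> is the sum of those
  for \<open>(u, w)\<close> and \<open>(w, v)\<close>, each bounded by its own winding.\<close>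

lemma optimal_cut_split_iff:
  assumes "u permutes {1..n}" "v permutes {1..n}" "w permutes {1..n}" "k \<le> n" "optimal_cut n u v k r"
  shows "winding n u w k + winding n w v k = winding n u v k \<longleftrightarrow>
    optimal_cut n u w k r \<and> optimal_cut n w v k r"
proof -
  have r: "r \<in> {1..n}" using assms(5) by (simp add: optimal_cut_def)
  show ?thesis
    using optimal_cut_iff_winding[of u n v k r] optimal_cut_iff_winding[of u n w k r]
      optimal_cut_iff_winding[of w n v k r] tail_count_diff_le_winding[of u n w k r]
      tail_count_diff_le_winding[of w n v k r] assms r
    by linarith
qed

lemma ex_optimal_cut:
  assumes "1 \<le> n"
  shows "\<exists>r. optimal_cut n u v k r"
proof -
  have "\<exists>r\<in>{1..n}. \<forall>s\<in>{1..n}. \<not> tail_count v k s - tail_count u k s < tail_count v k r - tail_count u k r"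
    using ex_is_arg_min_if_finite[of "{1..n}" "\<lambda>s. tail_count v k s - tail_count u k s"] assms
    unfolding is_arg_min_def by fastforce
  then show ?thesis
    unfolding optimal_cut_def by (meson not_less)
qed

text \<open>One more entry changes the objective \<open>g\<close> by \<open>d\<close>, whose values
  are \<open>c\<close> or \<open>c + 1\<close>. A minimiser of \<open>g\<close> with
  \<open>d = c\<close> also minimises \<open>g + d\<close>; without one, all minimisers of
  \<open>g\<close> have \<open>d = c + 1\<close>, and other cuts are worse by at least 1 in
  \<open>g\<close>.\<close>

lemma ex_common_optimal_cut:
  assumes "1 \<le> n"
  shows "\<exists>r. optimal_cut n u v k r \<and> optimal_cut n u v (Suc k) r"
proof -
  define g where "g s = tail_count v k s - tail_count u k s" for s
  define d :: "nat \<Rightarrow> int" where "d s = of_bool (s \<le> v (Suc k)) - of_bool (s \<le> u (Suc k))" for s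
  have opt: "optimal_cut n u v k r \<longleftrightarrow> r \<in> {1..n} \<and> (\<forall>s\<in>{1..n}. g r \<le> g s)" for r
    by (simp add: optimal_cut_def g_def)
  have opt': "optimal_cut n u v (Suc k) r \<longleftrightarrow> r \<in> {1..n} \<and> (\<forall>s\<in>{1..n}. g r + d r \<le> g s + d s)" for r
    by (simp add: optimal_cut_def g_def d_def algebra_simps)
  obtain c where c: "c \<le> d s" "d s \<le> c + 1" for s
  proof (cases "u (Suc k) \<le> v (Suc k)")
    case True
    then show ?thesis using that[of 0] by (auto simp: d_def)
  next
    case False
    then show ?thesis using that[of "-1"] by (auto simp: d_def)
  qed
  show ?thesis
  proof (cases "\<exists>r. optimal_cut n u v k r \<and> d r = c")
    case True
    then obtain r where r: "optimal_cut n u v k r" "d r = c" by blast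
    then show ?thesis using c unfolding opt opt' by (metis add_mono)
  next
    case False
    obtain r where r: "optimal_cut n u v k r" using ex_optimal_cut[OF assms] by blast
    have "g r + d r \<le> g s + d s" if "s \<in> {1..n}" for s
    proof (cases "optimal_cut n u v k s")
      case True
      have "d s = c + 1" using False True c[of s] by (smt (verit))
      then show ?thesis using r c(2)[of r] that unfolding opt by (smt (verit))
    next
      case False
      then have "g r < g s" using r that unfolding opt by (smt (verit))
      then show ?thesis using c(1)[of s] c(2)[of r] by linarith
    qed
    then show ?thesis using r unfolding opt opt' by blast
  qed
qed

section \<open>Change of length under a transposition\<close>

lemma perm_length_transpose:
  assumes w: "w permutes {1..n}" and i: "1 \<le> i" and ij: "i < j" and j: "j \<le> n"
  shows "int (perm_length n (w \<circ> transpose i j)) = int (perm_length n w) + (if w i < w j then 1 else - 1)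
    + 2 * (\<Sum>m\<in>{i<..<j}. of_bool (w m < w j) - of_bool (w m < w i))"
proof -
  let ?I = "{1..n}" and ?t = "transpose i j"
  have sum_form: "int (perm_length n x) = (\<Sum>a\<in>?I. \<Sum>b\<in>?I. of_bool (a < b \<and> x b < x a))" for x
  proof -
    have "int (perm_length n x) = (\<Sum>p\<in>?I \<times> ?I. of_bool (fst p < snd p \<and> x (snd p) < x (fst p)))"
      unfolding perm_length_def
      by (simp, intro arg_cong[where f = card]) auto
    then show ?thesis by (simp only: sum.cartesian_product case_prod_unfold)
  qed
  have t: "?t permutes ?I" using i ij j by (intro permutes_swap_id) auto
  \<comment> \<open>The contribution of the position pair \<open>(a, b)\<close> of \<open>w\<close>
    to the change, once the inversions of the swapped permutation are reindexed by
    \<open>?t\<close>.\<close>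
  define f :: "nat \<Rightarrow> nat \<Rightarrow> int" where
    "f a b = (if w b < w a then of_bool (?t a < ?t b) - of_bool (a < b) else 0)" for a b
  have "int (perm_length n (w \<circ> ?t)) = (\<Sum>a\<in>?I. \<Sum>b\<in>?I. of_bool (?t a < ?t b \<and> w b < w a))"
  proof -
    have "(\<Sum>a\<in>?I. \<Sum>b\<in>?I. of_bool (?t a < ?t b \<and> w b < w a)) =
      (\<Sum>a\<in>?I. \<Sum>b\<in>?I. of_bool (?t (?t a) < ?t (?t b) \<and> w (?t b) < w (?t a)) :: int)"
      by (subst sum.permute[OF t], subst sum.permute[OF t]) simp
    then show ?thesis by (simp add: sum_form)
  qed
  then have diff: "int (perm_length n (w \<circ> ?t)) - int (perm_length n w) = (\<Sum>a\<in>?I. \<Sum>b\<in>?I. f a b)"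
    by (simp only: sum_form sum_subtractf[symmetric]) (auto intro!: sum.cong simp: f_def)
  define S where "S = ?I - {i, j}"
  have I: "?I = insert i (insert j S)" "finite S" "i \<notin> S" "j \<notin> S"
    using i ij j by (auto simp: S_def)
  have inj: "w a = w b \<longleftrightarrow> a = b" for a b
    using permutes_inj[OF w] by (auto dest: injD)
  have zero: "f a b = 0" if "a \<in> S" "b \<in> S" for a b
    using that by (simp add: f_def S_def)
  have diag: "f a a = 0" for a by (simp add: f_def)
  have "(\<Sum>a\<in>?I. \<Sum>b\<in>?I. f a b) = f i j + f j i + (\<Sum>m\<in>S. f i m + f m i + f j m + f m j)"
    unfolding I(1) using I(2-4) ij
    by (simp add: diag sum.distrib zero algebra_simps)
  also have "f i j + f j i = (if w i < w j then 1 else - 1)"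
    using ij inj[of i j] by (auto simp: f_def)
  \<comment> \<open>A position outside the segment keeps its order relative to both swapped ones;
    one strictly inside has both orders reversed.\<close>
  also have "(\<Sum>m\<in>S. f i m + f m i + f j m + f m j) =
    (\<Sum>m\<in>S. if i < m \<and> m < j then 2 * (of_bool (w m < w j) - of_bool (w m < w i)) else 0)"
  proof (rule sum.cong)
    fix m assume "m \<in> S"
    then have "m \<noteq> i" "m \<noteq> j" "w m \<noteq> w i" "w m \<noteq> w j" by (auto simp: S_def inj)
    then show "f i m + f m i + f j m + f m j =
        (if i < m \<and> m < j then 2 * (of_bool (w m < w j) - of_bool (w m < w i)) else 0)"
      using ij by (auto simp: f_def)
  qed simp
  also have "\<dots> = (\<Sum>m\<in>{i<..<j}. 2 * (of_bool (w m < w j) - of_bool (w m < w i)))"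
  proof -
    have "S \<inter> {m. i < m \<and> m < j} = {i<..<j}" using i j by (auto simp: S_def)
    then show ?thesis by (simp add: sum.inter_restrict[symmetric] sum.If_cases I(2))
  qed
  finally show ?thesis using diff by (simp add: sum_distrib_left)
qed

section \<open>Edges of the quantum Bruhat graph and the distance formula\<close>

lemma quantum_bruhat_graph_iff:
  "(w, w') \<in> quantum_bruhat_graph n \<longleftrightarrow> w permutes {1..n} \<and>
     (\<exists>i j. 1 \<le> i \<and> i < j \<and> j \<le> n \<and> w' = w \<circ> transpose i j \<and>
        (int (perm_length n w') = int (perm_length n w) + 1 \<or>
         int (perm_length n w') = int (perm_length n w) + 1 - 2 * (int j - int i)))"
proof -
  have "i \<in> {1..n} \<and> j \<in> {1..n} \<and> i < j \<longleftrightarrow> 1 \<le> i \<and> i < j \<and> j \<le> n" for i j :: nat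
    by auto
  then show ?thesis unfolding quantum_bruhat_graph_def by blast
qed

lemma quantum_bruhat_graph_permutes:
  assumes "(w, w') \<in> quantum_bruhat_graph n"
  shows "w permutes {1..n}" "w' permutes {1..n}"
proof -
  show w: "w permutes {1..n}" using assms by (simp add: quantum_bruhat_graph_iff)
  obtain i j where "1 \<le> i" "i < j" "j \<le> n" and w': "w' = w \<circ> transpose i j"
    using assms by (auto simp: quantum_bruhat_graph_iff)
  then have "transpose i j permutes {1..n}" by (intro permutes_swap_id) auto
  then show "w' permutes {1..n}" unfolding w' using w by (rule permutes_compose)
qed

lemma sum_indicator_segment:
  fixes i j n :: nat
  assumes "1 \<le> i" "i < j" "j \<le> n"
  shows "(\<Sum>k=1..n. if i \<le> k \<and> k < j then 1 else 0 :: int) = int j - int i"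
proof -
  have "{1..n} \<inter> {k. i \<le> k \<and> k < j} = {i..<j}" using assms by auto
  then show ?thesis using assms by (simp add: sum.If_cases)
qed

text \<open>Whether \<open>w i < w j\<close> decides the kind of edge, because the sum over
  intermediate positions has weakly the matching sign and excludes the other length condition. An up
  edge needs no wrap, a down edge at most one per prefix from \<open>i\<close> to
  \<open>j - 1\<close>.\<close>

lemma tilted_length_edge_le:
  assumes "(w, w') \<in> quantum_bruhat_graph n"
  shows "tilted_length n w w' \<le> 1"
proof -
  obtain i j where ij: "1 \<le> i" "i < j" "j \<le> n" and w': "w' = w \<circ> transpose i j"
    and len: "int (perm_length n w') = int (perm_length n w) + 1 \<or>
         int (perm_length n w') = int (perm_length n w) + 1 - 2 * (int j - int i)"
    using assms by (auto simp: quantum_bruhat_graph_iff)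
  have w: "w permutes {1..n}" using assms by (rule quantum_bruhat_graph_permutes)
  note diff = perm_length_transpose[OF w ij]
  note tail = tail_count_transpose[OF ij(1,2), of w, folded w']
  show ?thesis
  proof (cases "w i < w j")
    case True
    then have "(\<Sum>m\<in>{i<..<j}. of_bool (w m < w j) - of_bool (w m < w i) :: int) \<ge> 0"
      by (intro sum_nonneg) auto
    then have "int (perm_length n w') = int (perm_length n w) + 1"
      using diff len True ij unfolding w' by auto
    moreover have "winding n w w' k \<le> 0" for k
      by (rule winding_le) (use True in \<open>auto simp: tail\<close>)
    then have "(\<Sum>k=1..n. winding n w w' k) \<le> 0"
      by (simp add: sum_nonpos)
    ultimately show ?thesis by (simp add: tilted_length_def)
  next
    case False
    then have "(\<Sum>m\<in>{i<..<j}. of_bool (w m < w j) - of_bool (w m < w i) :: int) \<le> 0"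
      by (intro sum_nonpos) auto
    then have "int (perm_length n w') = int (perm_length n w) + 1 - 2 * (int j - int i)"
      using diff len False unfolding w' by auto
    moreover have "winding n w w' k \<le> (if i \<le> k \<and> k < j then 1 else 0)" for k
      by (rule winding_le) (simp add: tail)
    then have "(\<Sum>k=1..n. winding n w w' k) \<le> int j - int i"
      by (subst sum_indicator_segment[OF ij, symmetric]) (intro sum_mono)
    ultimately show ?thesis by (simp add: tilted_length_def)
  qed
qed

lemma tilted_length_triangle:
  assumes "u permutes {1..n}" "v permutes {1..n}" "w permutes {1..n}"
  shows "tilted_length n u v \<le> tilted_length n u w + tilted_length n w v"
proof -
  have "(\<Sum>k=1..n. winding n u v k) \<le> (\<Sum>k=1..n. winding n u w k + winding n w v k)"
    using assms by (intro sum_mono winding_triangle) auto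
  then show ?thesis by (simp add: tilted_length_def sum.distrib)
qed

lemma tilted_length_self: "tilted_length n u u = 0"
proof -
  have "winding n u u k = 0" for k
    unfolding winding_def by simp
  then show ?thesis by (simp add: tilted_length_def)
qed

lemma tilted_length_le_relpow:
  assumes "(u, v) \<in> quantum_bruhat_graph n ^^ d" "u permutes {1..n}"
  shows "v permutes {1..n} \<and> tilted_length n u v \<le> int d"
  using assms(1)
proof (induction d arbitrary: v)
  case 0
  then show ?case using assms(2) by (simp add: tilted_length_self)
next
  case (Suc d)
  then obtain w where w: "(u, w) \<in> quantum_bruhat_graph n ^^ d" "(w, v) \<in> quantum_bruhat_graph n"
    by auto
  then show ?case
    using Suc.IH[OF w(1)] tilted_length_edge_le[OF w(2)] quantum_bruhat_graph_permutes[OF w(2)]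
      tilted_length_triangle[OF assms(2), of v w] by auto
qed

text \<open>
  Let \<open>i\<close> be the first position where \<open>u\<close> and \<open>v\<close> differ and \<open>j > i\<close> the first later one whose entry in
  \<open>u\<close> lies cyclically after \<open>u\<^sub>i\<close> and up to \<open>v\<^sub>i\<close>. Comparing a cut \<open>s\<close> in that arc with the cut just
  after \<open>v\<^sub>i\<close> shows that for \<open>i \<le> k < j\<close> the cut \<open>s\<close> still has to be crossed.
\<close>

lemma ex_geodesic_edge:
  assumes u: "u permutes {1..n}" and v: "v permutes {1..n}" and "u \<noteq> v"
  shows "\<exists>w. (u, w) \<in> quantum_bruhat_graph n \<and> tilted_length n w v \<le> tilted_length n u v - 1"
proof -
  define i where "i = (LEAST i. u i \<noteq> v i)"
  have ex: "\<exists>i. u i \<noteq> v i" using \<open>u \<noteq> v\<close> by auto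
  have ui: "u i \<noteq> v i" unfolding i_def using ex by (rule LeastI_ex)
  have before: "u m = v m" if "m < i" for m
    using not_less_Least[of m "\<lambda>i. u i \<noteq> v i"] that unfolding i_def by blast
  have i: "1 \<le> i" "i \<le> n"
    using ui permutes_not_in[OF u, of i] permutes_not_in[OF v, of i] by force+
  have range: "u m \<in> {1..n}" "v m \<in> {1..n}" if "m \<in> {1..n}" for m
    using that permutes_in_image[OF u] permutes_in_image[OF v] by auto
  \<comment> \<open>The cyclic arc from just after \<open>u i\<close> to \<open>v i\<close>; it
    wraps past \<open>n\<close> when \<open>v i < u i\<close>.\<close>
  define cyc where "cyc x \<longleftrightarrow> (if u i < v i then u i < x \<and> x \<le> v i else u i < x \<or> x \<le> v i)" for x
  define j where "j = (LEAST j. i < j \<and> j \<le> n \<and> cyc (u j))"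
  have "\<exists>j. i < j \<and> j \<le> n \<and> cyc (u j)"
  proof -
    have "v i \<in> u ` {1..n}" using range i permutes_image[OF u] by auto
    then obtain m where m: "m \<in> {1..n}" "u m = v i" by auto
    have "\<not> m < i"
    proof
      assume "m < i"
      then have "v m = v i" using before m(2) by simp
      then show False using \<open>m < i\<close> permutes_inj[OF v] by (auto dest: injD)
    qed
    moreover have "m \<noteq> i" using m ui by auto
    ultimately show ?thesis
      using m ui by (intro exI[of _ m]) (auto simp: cyc_def)
  qed
  then have j: "i < j" "j \<le> n" "cyc (u j)"
    unfolding j_def by (metis (mono_tags, lifting) LeastI_ex)+
  have between: "\<not> cyc (u m)" if "i < m" "m < j" for m
    using not_less_Least[of m "\<lambda>j. i < j \<and> j \<le> n \<and> cyc (u j)"] that j(2) unfolding j_def by auto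
  define w where "w = u \<circ> transpose i j"
  have uij: "u i \<noteq> u j" using j permutes_inj[OF u] by (auto dest: injD)
  note diff = perm_length_transpose[OF u i(1) j(1,2), folded w_def]
  \<comment> \<open>By minimality of \<open>j\<close> no entry strictly between lies in the arc, so
    the intermediate terms are all 0 for an up swap and all -1 for a down swap.\<close>
  have len: "int (perm_length n w) = int (perm_length n u) + 1 - (if u i < u j then 0 else 2 * (int j - int i))"
  proof -
    have "of_bool (u m < u j) - of_bool (u m < u i) = (if u i < u j then 0 else - 1 :: int)"
      if "m \<in> {i<..<j}" for m
    proof -
      have "u m \<noteq> u i" using that permutes_inj[OF u] by (auto dest: injD)
      then show ?thesis
        using between[of m] that j(3) uij unfolding cyc_def by (auto split: if_splits)
    qed
    then have "(\<Sum>m\<in>{i<..<j}. of_bool (u m < u j) - of_bool (u m < u i)) =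
      (\<Sum>m\<in>{i<..<j}. if u i < u j then 0 else - 1 :: int)" by (intro sum.cong) auto
    then show ?thesis using diff j(1) by (auto simp: of_nat_diff)
  qed
  have edge: "(u, w) \<in> quantum_bruhat_graph n"
    unfolding quantum_bruhat_graph_iff using u i j(1,2) len w_def by (auto split: if_splits)
  have gap: "tail_count u k s - tail_count v k s \<le> winding n u v k - 1"
    if k: "i \<le> k" "k < j" and s: "cyc s" for k s
  proof -
    let ?s = "Suc (v i)"
    let ?I = "\<lambda>x. of_bool (s \<le> x) - of_bool (?s \<le> x) :: int"
    have kn: "k \<le> n" using k j by simp
    \<comment> \<open>Up to a constant, \<open>?I\<close> is the indicator of the cyclic arc from
      \<open>s\<close> to \<open>v i\<close>, a part of \<open>cyc\<close>. It contains
      \<open>v i\<close> but neither \<open>u i\<close> nor any \<open>u m\<close> with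
      \<open>i < m \<le> k\<close>; before \<open>i\<close> the terms cancel.\<close>
    have "1 \<le> (\<Sum>m=1..k. ?I (v m) - ?I (u m))"
    proof -
      have "(\<Sum>m=1..k. of_bool (m = i) :: int) \<le> (\<Sum>m=1..k. ?I (v m) - ?I (u m))"
      proof (rule sum_mono)
        fix m assume m: "m \<in> {1..k}"
        consider "m < i" | "m = i" | "i < m" by linarith
        then show "of_bool (m = i) \<le> ?I (v m) - ?I (u m)"
        proof cases
          case 1
          then show ?thesis using before by simp
        next
          case 2
          then show ?thesis using s ui by (auto simp: cyc_def split: if_splits)
        next
          case 3
          then have "\<not> cyc (u m)" using between m k by auto
          then show ?thesis using s 3 ui by (auto simp: cyc_def split: if_splits)
        qed
      qed
      moreover have "(\<Sum>m=1..k. of_bool (m = i) :: int) = 1"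
      proof -
        have "{1..k} \<inter> {m. m = i} = {i}" using i k by auto
        then show ?thesis by simp
      qed
      ultimately show ?thesis by simp
    qed
    also have "(\<Sum>m=1..k. ?I (v m) - ?I (u m)) =
      (tail_count v k s - tail_count v k ?s) - (tail_count u k s - tail_count u k ?s)"
      by (simp add: tail_count_def sum_subtractf)
    finally show ?thesis
      using tail_count_diff_le_winding[OF u v kn, of ?s] by linarith
  qed
  \<comment> \<open>For \<open>i \<le> k < j\<close>, an up edge raises counts only at cuts in the
    arc, where \<open>gap\<close> leaves a unit to spare. A down edge lowers the count at cuts above
    \<open>u j\<close> and up to \<open>u i\<close>; all others lie in the arc, and
    \<open>gap\<close> gives the drop.\<close>
  have wind: "winding n w v k \<le> winding n u v k -
      (if u i < u j then 0 else if i \<le> k \<and> k < j then 1 else 0)" if "k \<le> n" for k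
  proof (rule winding_le)
    fix s
    have "tail_count w k s = tail_count u k s +
        (if i \<le> k \<and> k < j then of_bool (s \<le> u j) - of_bool (s \<le> u i) else 0)"
      unfolding w_def using i j by (intro tail_count_transpose)
    moreover note tail_count_diff_le_winding[OF u v that, of s]
    moreover have "i \<le> k \<Longrightarrow> k < j \<Longrightarrow> cyc s \<Longrightarrow> tail_count u k s - tail_count v k s \<le> winding n u v k - 1"
      using gap by blast
    moreover have "u i < u j \<Longrightarrow> u i < s \<Longrightarrow> s \<le> u j \<Longrightarrow> cyc s"
      "\<not> u i < u j \<Longrightarrow> \<not> (u j < s \<and> s \<le> u i) \<Longrightarrow> cyc s"
      using j(3) ui by (auto simp: cyc_def split: if_splits)
    ultimately show "tail_count w k s - tail_count v k s \<le> winding n u v k -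
        (if u i < u j then 0 else if i \<le> k \<and> k < j then 1 else 0)"
      using uij by (cases "i \<le> k \<and> k < j"; cases "u i < u j"; cases "s \<le> u i"; cases "s \<le> u j") auto
  qed
  have "(\<Sum>k=1..n. winding n w v k) \<le> (\<Sum>k=1..n. winding n u v k -
      (if u i < u j then 0 else if i \<le> k \<and> k < j then 1 else 0))"
    using wind by (intro sum_mono) auto
  also have "\<dots> = (\<Sum>k=1..n. winding n u v k) - (if u i < u j then 0 else int j - int i)"
    using sum_indicator_segment[OF i(1) j(1,2)] by (simp add: sum_subtractf)
  finally have "tilted_length n w v \<le> tilted_length n u v - 1"
    using len by (auto simp: tilted_length_def split: if_splits)
  then show ?thesis using edge by blast
qed

lemma perm_length_le: "perm_length n w \<le> n * n"
proof -
  have "perm_length n w \<le> card ({1..n} \<times> {1..n})"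
    unfolding perm_length_def by (intro card_mono) auto
  then show ?thesis by simp
qed

text \<open>A crude bound, used before nonnegativity is known, which turns
  \<open>tilted_length\<close> into a natural-number measure after adding
  \<open>n * n\<close>.\<close>

lemma tilted_length_ge:
  assumes "u permutes {1..n}" "v permutes {1..n}"
  shows "- int (n * n) \<le> tilted_length n u v"
proof -
  have "0 \<le> winding n u v k" if "k \<in> {1..n}" for k
    using tail_count_diff_le_winding[OF assms, of k 0] that assms by (simp add: tail_count_outside)
  then have "0 \<le> (\<Sum>k=1..n. winding n u v k)" by (rule sum_nonneg)
  then show ?thesis using perm_length_le[of n u] unfolding tilted_length_def by linarith
qed

text \<open>Greedy edges lower the remaining \<open>tilted_length\<close> by at least 1 each; the
  lower bound for path lengths turns this into equality.\<close>

lemma ex_relpow_tilted_length: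
  assumes "u permutes {1..n}" "v permutes {1..n}"
  shows "\<exists>d. (u, v) \<in> quantum_bruhat_graph n ^^ d \<and> int d = tilted_length n u v"
  using assms(1)
proof (induction "nat (tilted_length n u v + int (n * n))" arbitrary: u rule: less_induct)
  case less
  show ?case
  proof (cases "u = v")
    case True
    then show ?thesis by (intro exI[of _ 0]) (simp add: tilted_length_self)
  next
    case False
    obtain w where edge: "(u, w) \<in> quantum_bruhat_graph n"
      and le: "tilted_length n w v \<le> tilted_length n u v - 1"
      using ex_geodesic_edge[OF less.prems assms(2) False] by blast
    have w: "w permutes {1..n}" using edge by (rule quantum_bruhat_graph_permutes)
    have "nat (tilted_length n w v + int (n * n)) < nat (tilted_length n u v + int (n * n))"
      using le tilted_length_ge[OF w assms(2)] by linarith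
    from less.hyps[OF this w] obtain d where
      d: "(w, v) \<in> quantum_bruhat_graph n ^^ d" "int d = tilted_length n w v" by blast
    have path: "(u, v) \<in> quantum_bruhat_graph n ^^ Suc d"
      using edge d(1) by (rule relpow_Suc_I2)
    then have "tilted_length n u v \<le> int (Suc d)"
      using tilted_length_le_relpow less.prems by blast
    then show ?thesis using path d(2) le by (intro exI[of _ "Suc d"]) auto
  qed
qed

lemma qb_dist_eq_tilted_length:
  assumes "u permutes {1..n}" "v permutes {1..n}"
  shows "int (qb_dist n u v) = tilted_length n u v"
proof -
  obtain d where d: "(u, v) \<in> quantum_bruhat_graph n ^^ d" "int d = tilted_length n u v"
    using ex_relpow_tilted_length[OF assms] by blast
  have "qb_dist n u v = d"
    unfolding qb_dist_def
  proof (rule Least_equality)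
    fix d' assume "(u, v) \<in> quantum_bruhat_graph n ^^ d'"
    then show "d \<le> d'" using tilted_length_le_relpow[OF _ assms(1)] d(2) by fastforce
  qed (rule d(1))
  then show ?thesis using d by simp
qed

section \<open>Tilted intervals, prefix by prefix\<close>

lemma mem_tilted_interval_iff:
  assumes "u permutes {1..n}" "v permutes {1..n}"
  shows "w \<in> tilted_interval n u v \<longleftrightarrow>
    w permutes {1..n} \<and> tilted_length n u w + tilted_length n w v \<le> tilted_length n u v"
proof (cases "w permutes {1..n}")
  case True
  have "qb_dist n u w + qb_dist n w v = qb_dist n u v \<longleftrightarrow>
      int (qb_dist n u w) + int (qb_dist n w v) = int (qb_dist n u v)"
    by linarith
  then show ?thesis
    using True assms tilted_length_triangle[of u n v w]
    unfolding tilted_interval_def by (auto simp: qb_dist_eq_tilted_length)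
qed (simp add: tilted_interval_def)

text \<open>The length terms telescope, so the defect in the triangle inequality is twice a sum of
  nonnegative winding defects.\<close>

lemma mem_tilted_interval_iff_winding:
  assumes "u permutes {1..n}" "v permutes {1..n}" "w permutes {1..n}"
  shows "w \<in> tilted_interval n u v \<longleftrightarrow>
    (\<forall>k\<in>{1..n}. winding n u w k + winding n w v k = winding n u v k)"
proof -
  have nonneg: "\<And>k. k \<in> {1..n} \<Longrightarrow> 0 \<le> winding n u w k + winding n w v k - winding n u v k"
    using winding_triangle[of u n v w] assms by fastforce
  have nonneg_sum: "0 \<le> (\<Sum>k=1..n. winding n u w k + winding n w v k - winding n u v k)"
    by (rule sum_nonneg) (rule nonneg)
  have "tilted_length n u w + tilted_length n w v - tilted_length n u v =
      2 * (\<Sum>k=1..n. winding n u w k + winding n w v k - winding n u v k)"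
    by (simp add: tilted_length_def sum.distrib sum_subtractf algebra_simps)
  then have "w \<in> tilted_interval n u v \<longleftrightarrow>
      (\<Sum>k=1..n. winding n u w k + winding n w v k - winding n u v k) = 0"
    using nonneg_sum assms by (auto simp: mem_tilted_interval_iff)
  then show ?thesis
    using sum_nonneg_eq_0_iff[of "{1..n}" "\<lambda>k. winding n u w k + winding n w v k - winding n u v k"] nonneg
    by simp
qed

lemma optimal_cut_0: "r \<in> {1..n} \<Longrightarrow> optimal_cut n u v 0 r"
  by (simp add: optimal_cut_def)

lemma tilted_interval_optimal_cut:
  assumes "u permutes {1..n}" "v permutes {1..n}" "w \<in> tilted_interval n u v" "k \<le> n"
    and "optimal_cut n u v k r"
  shows "optimal_cut n u w k r" "optimal_cut n w v k r"
proof -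
  have w: "w permutes {1..n}" using assms(3) by (simp add: tilted_interval_def)
  have "r \<in> {1..n}" using assms(5) by (simp add: optimal_cut_def)
  then have "optimal_cut n u w k r \<and> optimal_cut n w v k r"
  proof (cases "k = 0")
    case False
    then have "k \<in> {1..n}" using assms(4) by simp
    then show ?thesis
      using mem_tilted_interval_iff_winding[OF assms(1,2) w] assms(3)
        optimal_cut_split_iff[OF assms(1,2) w assms(4,5)] by blast
  qed (simp add: optimal_cut_0)
  then show "optimal_cut n u w k r" "optimal_cut n w v k r" by auto
qed

text \<open>Membership is tested on each prefix separately, so after a swap of adjacent entries only
  one prefix has to be rechecked, at a single optimal cut.\<close>

lemma mem_tilted_interval_change_one:
  assumes "u permutes {1..n}" "v permutes {1..n}" "w \<in> tilted_interval n u v" "w' permutes {1..n}"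
    and "i \<in> {1..n}"
    and same: "\<And>k. k \<noteq> i \<Longrightarrow> k \<le> n \<Longrightarrow> tail_count w' k = tail_count w k"
    and "optimal_cut n u v i r" "optimal_cut n u w' i r" "optimal_cut n w' v i r"
  shows "w' \<in> tilted_interval n u v"
proof -
  have w: "w permutes {1..n}" using assms(3) by (simp add: tilted_interval_def)
  have "winding n u w' k + winding n w' v k = winding n u v k" if k: "k \<in> {1..n}" for k
  proof (cases "k = i")
    case True
    then show ?thesis using optimal_cut_split_iff[of u n v w' i r] assms by auto
  next
    case False
    then have "winding n u w' k + winding n w' v k = winding n u w k + winding n w v k"
      using same k by (simp add: winding_def)
    then show ?thesis using mem_tilted_interval_iff_winding[OF assms(1,2) w] assms(3) k by simp
  qed
  then show ?thesis using mem_tilted_interval_iff_winding[OF assms(1,2,4)] by blast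
qed

section \<open>Rotated orders and the tilted order\<close>

lemma rot_less_trans: "rot_less r x y \<Longrightarrow> rot_less r y z \<Longrightarrow> rot_less r x z"
  unfolding rot_less_def by auto

lemma rot_less_irrefl: "\<not> rot_less r x x"
  by (simp add: rot_less_def)

lemma rot_less_linear: "rot_less r x y \<or> x = y \<or> rot_less r y x"
  unfolding rot_less_def by linarith

lemma sorted_wrt_rot_less_distinct: "sorted_wrt (rot_less r) xs \<Longrightarrow> distinct xs"
  by (induction xs) (auto simp: rot_less_irrefl)

lemma ex_sorted_wrt_rot_less:
  assumes "finite A"
  shows "\<exists>xs. set xs = A \<and> sorted_wrt (rot_less r) xs"
proof -
  let ?l = "\<lambda>S. sorted_list_of_set (A \<inter> S)"
  have "sorted_wrt (rot_less r) (?l {r..})"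
    by (rule sorted_wrt_mono_rel[OF _ strict_sorted_list_of_set]) (use assms in \<open>auto simp: rot_less_def\<close>)
  moreover have "sorted_wrt (rot_less r) (?l {..<r})"
    by (rule sorted_wrt_mono_rel[OF _ strict_sorted_list_of_set]) (use assms in \<open>auto simp: rot_less_def\<close>)
  ultimately have "sorted_wrt (rot_less r) (?l {r..} @ ?l {..<r})"
    using assms by (auto simp: sorted_wrt_append rot_less_def)
  moreover have "set (?l {r..} @ ?l {..<r}) = A" using assms by auto
  ultimately show ?thesis by blast
qed

text \<open>If the enumerations fail to compare at index \<open>j\<close>, the upper set of
  \<open>xs ! j\<close> has at least \<open>length xs - j\<close> elements in \<open>A\<close> and
  fewer in \<open>B\<close>. Tests at \<open>s \<in> A\<close> keep the cuts in
  \<open>{1..n}\<close> when \<open>A\<close> is a prefix set.\<close>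

lemma rot_set_le_iff_card:
  assumes "finite A" "finite B" "card A = card B"
  shows "rot_set_le r A B \<longleftrightarrow> (\<forall>s\<in>A. card (A \<inter> {x. rot_le r s x}) \<le> card (B \<inter> {x. rot_le r s x}))"
    and "rot_set_le r A B \<Longrightarrow> card (A \<inter> {x. rot_le r s x}) \<le> card (B \<inter> {x. rot_le r s x})"
proof -
  show card_le: "card (A \<inter> {x. rot_le r s x}) \<le> card (B \<inter> {x. rot_le r s x})" if rot: "rot_set_le r A B" for s
  proof -
    obtain xs ys where xs: "set xs = A" "sorted_wrt (rot_less r) xs"
      and ys: "set ys = B" "sorted_wrt (rot_less r) ys" and le: "list_all2 (rot_le r) xs ys"
      using rot unfolding rot_set_le_def by blast
    have "length (filter (rot_le r s) xs) \<le> length (filter (rot_le r s) ys)"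
      using le by (induction rule: list_all2_induct) (auto simp: rot_le_def dest: rot_less_trans)
    then show ?thesis
      using xs(1) ys(1) sorted_wrt_rot_less_distinct[OF xs(2)] sorted_wrt_rot_less_distinct[OF ys(2)]
      by (simp add: distinct_length_filter Int_commute)
  qed
  have "rot_set_le r A B" if le: "\<forall>s\<in>A. card (A \<inter> {x. rot_le r s x}) \<le> card (B \<inter> {x. rot_le r s x})"
  proof -
    obtain xs where xs: "set xs = A" "sorted_wrt (rot_less r) xs"
      using ex_sorted_wrt_rot_less[OF assms(1)] by blast
    obtain ys where ys: "set ys = B" "sorted_wrt (rot_less r) ys"
      using ex_sorted_wrt_rot_less[OF assms(2)] by blast
    have dist: "distinct xs" "distinct ys"
      using xs ys by (auto intro: sorted_wrt_rot_less_distinct)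
    then have len: "length xs = length ys"
      using xs ys assms(3) by (metis distinct_card)
    have "rot_le r (xs ! j) (ys ! j)" if j: "j < length xs" for j
    proof (rule ccontr)
      assume "\<not> rot_le r (xs ! j) (ys ! j)"
      then have less: "rot_less r (ys ! j) (xs ! j)"
        using rot_less_linear unfolding rot_le_def by blast
      have "set (drop j xs) \<subseteq> A \<inter> {x. rot_le r (xs ! j) x}"
      proof
        fix x assume "x \<in> set (drop j xs)"
        then obtain m where m: "j \<le> m" "m < length xs" "x = xs ! m"
          by (auto simp: in_set_conv_nth intro!: that[of "j + _"])
        then have "rot_le r (xs ! j) x"
          using sorted_wrt_nth_less[OF xs(2), of j m] by (cases "j = m") (auto simp: rot_le_def)
        then show "x \<in> A \<inter> {x. rot_le r (xs ! j) x}" using m xs(1) by auto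
      qed
      then have "card (set (drop j xs)) \<le> card (A \<inter> {x. rot_le r (xs ! j) x})"
        using assms(1) by (intro card_mono) auto
      then have 1: "length xs - j \<le> card (A \<inter> {x. rot_le r (xs ! j) x})"
        using dist(1) by (simp add: distinct_card)
      have "B \<inter> {x. rot_le r (xs ! j) x} \<subseteq> set (drop (Suc j) ys)"
      proof
        fix y assume y: "y \<in> B \<inter> {x. rot_le r (xs ! j) x}"
        then obtain m where m: "m < length ys" "y = ys ! m" using ys(1) by (auto simp: in_set_conv_nth)
        have yj: "rot_less r (ys ! j) y" using less y rot_less_trans unfolding rot_le_def by blast
        have "j < m"
        proof (rule ccontr)
          assume "\<not> j < m"
          then have "rot_less r y (ys ! j) \<or> y = ys ! j"
            using sorted_wrt_nth_less[OF ys(2), of m j] m j len by (cases "m = j") auto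
          then show False using yj rot_less_trans rot_less_irrefl by blast
        qed
        then show "y \<in> set (drop (Suc j) ys)"
          using m by (auto simp: in_set_conv_nth intro!: exI[of _ "m - Suc j"])
      qed
      then have "card (B \<inter> {x. rot_le r (xs ! j) x}) \<le> card (set (drop (Suc j) ys))"
        by (intro card_mono) auto
      then have 2: "card (B \<inter> {x. rot_le r (xs ! j) x}) \<le> length ys - Suc j"
        using dist(2) by (simp add: distinct_card)
      have "xs ! j \<in> A" using j xs(1) by auto
      then show False using le 1 2 j len by fastforce
    qed
    then have "list_all2 (rot_le r) xs ys" using len by (simp add: list_all2_conv_all_nth)
    then show ?thesis unfolding rot_set_le_def using xs ys by blast
  qed
  then show "rot_set_le r A B \<longleftrightarrow> (\<forall>s\<in>A. card (A \<inter> {x. rot_le r s x}) \<le> card (B \<inter> {x. rot_le r s x}))"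
    using card_le by blast
qed

lemma card_image_Int:
  fixes w :: "nat \<Rightarrow> nat"
  assumes "inj w"
  shows "int (card (w ` {1..k} \<inter> S)) = (\<Sum>m=1..k. of_bool (w m \<in> S))"
proof -
  have "w ` {1..k} \<inter> S = w ` ({1..k} \<inter> {m. w m \<in> S})" by auto
  moreover have "inj_on w ({1..k} \<inter> {m. w m \<in> S})" using assms by (rule inj_on_subset) simp
  ultimately have "card (w ` {1..k} \<inter> S) = card ({1..k} \<inter> {m. w m \<in> S})"
    by (simp only: card_image)
  then show ?thesis
    using sum_of_bool_eq[of "{1..k}" "\<lambda>m. w m \<in> S", where 'a = int] by simp
qed

text \<open>An upper set of the rotated order is a cyclic arc from \<open>s\<close> to
  \<open>r - 1\<close>, whose indicator is a difference of two threshold indicators, plus 1 if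
  \<open>r \<le> s\<close>.\<close>

lemma card_image_rot_le:
  assumes "inj w"
  shows "int (card (w ` {1..k} \<inter> {x. rot_le r s x})) =
    tail_count w k s - tail_count w k r + (if r \<le> s then int k else 0)"
proof -
  have "(of_bool (rot_le r s x) :: int) = of_bool (s \<le> x) - of_bool (r \<le> x) + of_bool (r \<le> s)" for x
    by (auto simp: rot_le_def rot_less_def)
  then show ?thesis
    by (simp only: card_image_Int[OF assms] mem_Collect_eq tail_count_def) (simp add: sum.distrib sum_subtractf)
qed

lemma card_image_cyclic_interval:
  assumes "w permutes {1..n}" "k \<le> n" "a \<in> {1..n}" "b \<in> {1..n}"
  shows "int (card (w ` {1..k} \<inter> cyclic_interval n a b)) =
    tail_count w k a - tail_count w k b + (if b < a then int k else 0)"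
proof -
  have "int (card (w ` {1..k} \<inter> cyclic_interval n a b)) = (\<Sum>m=1..k. of_bool (w m \<in> cyclic_interval n a b))"
    using permutes_inj[OF assms(1)] by (rule card_image_Int)
  also have "\<dots> = (\<Sum>m=1..k. of_bool (a \<le> w m) - of_bool (b \<le> w m) + of_bool (b < a))"
  proof (rule sum.cong)
    fix m assume "m \<in> {1..k}"
    then have "w m \<in> {1..n}" using permutes_in_image[OF assms(1), of m] assms(2) by auto
    then show "of_bool (w m \<in> cyclic_interval n a b) =
        (of_bool (a \<le> w m) - of_bool (b \<le> w m) + of_bool (b < a) :: int)"
      using assms(3,4) by (auto simp: cyclic_interval_def)
  qed simp
  finally show ?thesis
    by (simp add: tail_count_def sum.distrib sum_subtractf)
qed

lemma rot_set_le_iff_optimal_cut: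
  assumes "u permutes {1..n}" "v permutes {1..n}" "k \<le> n" "r \<in> {1..n}"
  shows "rot_set_le r (u ` {1..k}) (v ` {1..k}) \<longleftrightarrow> optimal_cut n u v k r"
proof -
  have inj: "inj u" "inj v" using assms by (auto intro: permutes_inj)
  have card: "card (u ` {1..k}) = card (v ` {1..k})"
    using inj by (simp add: card_image inj_on_subset[OF _ subset_UNIV])
  have sub: "u ` {1..k} \<subseteq> {1..n}"
    using permutes_image[OF assms(1)] assms(3) by (metis atLeastatMost_subset_iff image_mono order_refl)
  have le: "card (u ` {1..k} \<inter> {x. rot_le r s x}) \<le> card (v ` {1..k} \<inter> {x. rot_le r s x}) \<longleftrightarrow>
      tail_count v k r - tail_count u k r \<le> tail_count v k s - tail_count u k s" for s
    using card_image_rot_le[OF inj(1), of k r s] card_image_rot_le[OF inj(2), of k r s] by auto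
  show ?thesis
    using rot_set_le_iff_card[OF _ _ card, of r] sub assms(4)
    unfolding optimal_cut_def le by blast
qed

text \<open>The cyclic interval condition says that \<open>a k\<close> and \<open>a (k + 1)\<close>
  give equal differences on prefix \<open>k\<close>; as the first cut is optimal, so is the
  second.\<close>

lemma tilted_le_iff_optimal_cut:
  assumes "u permutes {1..n}" "v permutes {1..n}" "\<forall>k\<in>{1..n}. a k \<in> {1..n}"
  shows "tilted_le n a u v \<longleftrightarrow>
    (\<forall>k\<in>{1..n}. optimal_cut n u v k (a k)) \<and> (\<forall>k\<in>{1..n-1}. optimal_cut n u v k (a (k + 1)))"
proof -
  have le: "rot_set_le (a k) (u ` {1..k}) (v ` {1..k}) \<longleftrightarrow> optimal_cut n u v k (a k)" if "k \<in> {1..n}" for k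
    using rot_set_le_iff_optimal_cut[OF assms(1,2)] assms(3) that by simp
  have eq: "card (u ` {1..k} \<inter> cyclic_interval n (a k) (a (k + 1))) =
      card (v ` {1..k} \<inter> cyclic_interval n (a k) (a (k + 1))) \<longleftrightarrow> optimal_cut n u v k (a (k + 1))"
    if k: "k \<in> {1..n-1}" and opt: "optimal_cut n u v k (a k)" for k
  proof -
    have mem: "a k \<in> {1..n}" "a (k + 1) \<in> {1..n}" "k \<le> n" using assms(3) k by auto
    have "card (u ` {1..k} \<inter> cyclic_interval n (a k) (a (k + 1))) =
        card (v ` {1..k} \<inter> cyclic_interval n (a k) (a (k + 1))) \<longleftrightarrow>
        tail_count u k (a k) - tail_count v k (a k) = tail_count u k (a (k + 1)) - tail_count v k (a (k + 1))"
      using card_image_cyclic_interval[OF assms(1) mem(3,1,2)] card_image_cyclic_interval[OF assms(2) mem(3,1,2)]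
      by linarith
    then show ?thesis
      using opt optimal_cut_iff_winding[OF assms(1,2) mem(3)] mem by auto
  qed
  show ?thesis
    unfolding tilted_le_def using le eq by fastforce
qed

section \<open>Adjacent transpositions and lifting\<close>

text \<open>Moving up from \<open>w i\<close> to \<open>w (i + 1)\<close> in the order starting at
  \<open>r\<close> does not cross the cut \<open>r\<close>, so no cut gains less than
  \<open>r\<close>.\<close>

lemma optimal_cut_ascent_right:
  assumes "optimal_cut n u w i r" "1 \<le> i" "rot_less r (w i) (w (i + 1))"
  shows "optimal_cut n u (w \<circ> transpose i (i + 1)) i r"
proof -
  have "of_bool (r \<le> w (i + 1)) - of_bool (r \<le> w i) \<le> (of_bool (s \<le> w (i + 1)) - of_bool (s \<le> w i) :: int)" for s
    using assms(3) by (auto simp: rot_less_def)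
  then show ?thesis
    using assms(1,2) unfolding optimal_cut_def by (fastforce simp: tail_count_transpose)
qed

lemma optimal_cut_descent_left:
  assumes "optimal_cut n w v i r" "1 \<le> i" "rot_less r (w (i + 1)) (w i)"
  shows "optimal_cut n (w \<circ> transpose i (i + 1)) v i r"
proof -
  have "of_bool (s \<le> w (i + 1)) - of_bool (s \<le> w i) \<le> (of_bool (r \<le> w (i + 1)) - of_bool (r \<le> w i) :: int)" for s
    using assms(3) by (auto simp: rot_less_def)
  then show ?thesis
    using assms(1,2) unfolding optimal_cut_def by (fastforce simp: tail_count_transpose)
qed

text \<open>The excess of the difference at \<open>s\<close> over that at \<open>r\<close> is
  nonnegative on all three prefixes. If a swap made it negative, it would be 0 on prefix
  \<open>i - 1\<close>, and the ascent of \<open>u\<close> and descent of \<open>v\<close> would put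
  more of the next two entries of \<open>u\<close> than of \<open>v\<close> at or above
  \<open>s\<close>, making it negative on prefix \<open>i + 1\<close>.\<close>

lemma optimal_cut_lifting:
  assumes "1 \<le> i" "optimal_cut n u v (i - 1) r" "optimal_cut n u v i r" "optimal_cut n u v (i + 1) r"
    and "rot_less r (u i) (u (i + 1))" "rot_less r (v (i + 1)) (v i)"
  shows "optimal_cut n (u \<circ> transpose i (i + 1)) v i r" "optimal_cut n u (v \<circ> transpose i (i + 1)) i r"
proof -
  obtain k where k: "i = Suc k" using assms(1) by (cases i) auto
  have le: "tail_count v j r - tail_count u j r \<le> tail_count v j s - tail_count u j s"
    if "s \<in> {1..n}" "j \<in> {k, i, i + 1}" for s j
    using assms(2-4) that k unfolding optimal_cut_def by auto
  have r: "r \<in> {1..n}" using assms(3) by (simp add: optimal_cut_def)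
  have "tail_count v i r - tail_count (u \<circ> transpose i (i + 1)) i r
      \<le> tail_count v i s - tail_count (u \<circ> transpose i (i + 1)) i s \<and>
      tail_count (v \<circ> transpose i (i + 1)) i r - tail_count u i r
      \<le> tail_count (v \<circ> transpose i (i + 1)) i s - tail_count u i s" if s: "s \<in> {1..n}" for s
    using le[OF s, of k] le[OF s, of i] le[OF s, of "i + 1"] assms(1,5,6)
    by (auto simp: tail_count_transpose k rot_less_def of_bool_def split: if_splits)
  then show "optimal_cut n (u \<circ> transpose i (i + 1)) v i r" "optimal_cut n u (v \<circ> transpose i (i + 1)) i r"
    using r unfolding optimal_cut_def by auto
qed

lemma tail_count_adjacent_transpose:
  assumes "1 \<le> i" "k \<noteq> i"
  shows "tail_count (w \<circ> transpose i (i + 1)) k = tail_count w k"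
  using assms by (auto simp: tail_count_transpose)

lemma permutes_comp_adjacent_transpose:
  fixes i n :: nat
  assumes "w permutes {1..n}" "i \<in> {1..n-1}"
  shows "w \<circ> transpose i (i + 1) permutes {1..n}"
proof -
  have "transpose i (i + 1) permutes {1..n}"
    using assms(2) by (intro permutes_swap_id) auto
  then show ?thesis using assms(1) by (rule permutes_compose)
qed

lemma self_mem_tilted_interval:
  assumes "u permutes {1..n}" "v permutes {1..n}"
  shows "u \<in> tilted_interval n u v" "v \<in> tilted_interval n u v"
  using assms by (auto simp: mem_tilted_interval_iff tilted_length_self)

text \<open>If \<open>w\<close> ascends at \<open>i\<close>, the swap keeps \<open>r\<close> optimal
  on the side of \<open>u\<close> directly and on the side of \<open>v\<close> by lifting; if
  \<open>w\<close> descends, the roles are exchanged.\<close>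

lemma tilted_interval_adjacent_transpose_closed:
  assumes u: "u permutes {1..n}" and v: "v permutes {1..n}" and i: "i \<in> {1..n-1}"
    and opt: "optimal_cut n u v (i - 1) r" "optimal_cut n u v i r" "optimal_cut n u v (i + 1) r"
    and asc: "rot_less r (u i) (u (i + 1))" and des: "rot_less r (v (i + 1)) (v i)"
    and mem: "w \<in> tilted_interval n u v"
  shows "w \<circ> transpose i (i + 1) \<in> tilted_interval n u v"
proof -
  have i': "1 \<le> i" "i - 1 \<le> n" "i \<le> n" "i + 1 \<le> n" "i \<in> {1..n}" using i by auto
  have w: "w permutes {1..n}" using mem by (simp add: tilted_interval_def)
  have uw: "optimal_cut n u w (i - 1) r" "optimal_cut n u w i r" "optimal_cut n u w (i + 1) r"
    and wv: "optimal_cut n w v (i - 1) r" "optimal_cut n w v i r" "optimal_cut n w v (i + 1) r"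
    using tilted_interval_optimal_cut[OF u v mem] opt i' by blast+
  have "w i \<noteq> w (i + 1)" using inj_eq[OF permutes_inj[OF w]] by simp
  then consider "rot_less r (w i) (w (i + 1))" | "rot_less r (w (i + 1)) (w i)"
    using rot_less_linear by blast
  then have "optimal_cut n u (w \<circ> transpose i (i + 1)) i r \<and> optimal_cut n (w \<circ> transpose i (i + 1)) v i r"
  proof cases
    case 1
    then show ?thesis
      using optimal_cut_ascent_right[OF uw(2) i'(1)] optimal_cut_lifting(1)[OF i'(1) wv _ des] by blast
  next
    case 2
    then show ?thesis
      using optimal_cut_descent_left[OF wv(2) i'(1)] optimal_cut_lifting(2)[OF i'(1) uw asc] by blast
  qed
  then show ?thesis
    using mem_tilted_interval_change_one[OF u v mem permutes_comp_adjacent_transpose[OF w i] i'(5) _ opt(2)]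
      tail_count_adjacent_transpose i'(1) by blast
qed

text \<open>As \<open>r\<close> is optimal for \<open>u\<close> and its swap, the cyclic rise from
  \<open>u i\<close> to \<open>u (i + 1)\<close> does not cross \<open>r\<close>; these two entries
  serve as test cuts.\<close>

lemma rot_less_of_adjacent_transpose_right:
  assumes "u permutes {1..n}" "v permutes {1..n}" "i \<in> {1..n-1}" "optimal_cut n u v i r"
    and "u \<circ> transpose i (i + 1) \<in> tilted_interval n u v"
  shows "rot_less r (u i) (u (i + 1))"
proof -
  have ne: "u i \<noteq> u (i + 1)" using inj_eq[OF permutes_inj[OF assms(1)]] by simp
  have i: "1 \<le> i" "i \<le> n" using assms(3) by auto
  have mem: "u i \<in> {1..n}" "u (i + 1) \<in> {1..n}"
    unfolding permutes_in_image[OF assms(1)] using assms(3) by auto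
  have "optimal_cut n u (u \<circ> transpose i (i + 1)) i r"
    using tilted_interval_optimal_cut(1)[OF assms(1,2,5) i(2) assms(4)] .
  then have le: "of_bool (r \<le> u (i + 1)) - of_bool (r \<le> u i) \<le> (of_bool (s \<le> u (i + 1)) - of_bool (s \<le> u i) :: int)"
    if "s \<in> {1..n}" for s
    using i(1) that unfolding optimal_cut_def by (fastforce simp: tail_count_transpose)
  show ?thesis
    using le[of "u i"] le[of "u (i + 1)"] mem ne unfolding rot_less_def
    by (auto simp: of_bool_def split: if_splits)
qed

lemma rot_less_of_adjacent_transpose_left:
  assumes "u permutes {1..n}" "v permutes {1..n}" "i \<in> {1..n-1}" "optimal_cut n u v i r"
    and "v \<circ> transpose i (i + 1) \<in> tilted_interval n u v"
  shows "rot_less r (v (i + 1)) (v i)"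
proof -
  have ne: "v i \<noteq> v (i + 1)" using inj_eq[OF permutes_inj[OF assms(2)]] by simp
  have i: "1 \<le> i" "i \<le> n" using assms(3) by auto
  have mem: "v i \<in> {1..n}" "v (i + 1) \<in> {1..n}"
    unfolding permutes_in_image[OF assms(2)] using assms(3) by auto
  have "optimal_cut n (v \<circ> transpose i (i + 1)) v i r"
    using tilted_interval_optimal_cut(2)[OF assms(1,2,5) i(2) assms(4)] .
  then have le: "of_bool (s \<le> v (i + 1)) - of_bool (s \<le> v i) \<le> (of_bool (r \<le> v (i + 1)) - of_bool (r \<le> v i) :: int)"
    if "s \<in> {1..n}" for s
    using i(1) that unfolding optimal_cut_def by (fastforce simp: tail_count_transpose)
  show ?thesis
    using le[of "v i"] le[of "v (i + 1)"] mem ne unfolding rot_less_def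
    by (auto simp: of_bool_def split: if_splits)
qed

section \<open>Invariant intervals and cuts shared by three prefixes\<close>

text \<open>A greedy path from \<open>w\<close> to \<open>v\<close> stays in the interval. Each swap
  leaves one of the positions \<open>i\<close>, \<open>i + 1\<close> alone or exchanges them, so the
  common value of \<open>f\<close> is preserved.\<close>

lemma tilted_interval_invariant:
  fixes f :: "nat \<Rightarrow> 'a"
  assumes u: "u permutes {1..n}" and v: "v permutes {1..n}"
    and same: "\<And>w. w \<in> tilted_interval n u v \<Longrightarrow> f (w i) = f (w (i + 1))"
    and mem: "w \<in> tilted_interval n u v"
  shows "f (w i) = f (v i)"
  using mem
proof (induction "nat (tilted_length n w v)" arbitrary: w rule: less_induct)
  case less
  show ?case
  proof (cases "w = v")
    case False
    have w: "w permutes {1..n}" using less.prems by (simp add: tilted_interval_def)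
    obtain w' where edge: "(w, w') \<in> quantum_bruhat_graph n"
      and le: "tilted_length n w' v \<le> tilted_length n w v - 1"
      using ex_geodesic_edge[OF w v False] by blast
    have w': "w' permutes {1..n}" using edge by (rule quantum_bruhat_graph_permutes)
    \<comment> \<open>The edge costs at most 1 and the remaining length drops by at least 1.\<close>
    have mem': "w' \<in> tilted_interval n u v"
      using less.prems tilted_length_triangle[OF u w' w] tilted_length_edge_le[OF edge] le w'
      by (simp add: mem_tilted_interval_iff[OF u v])
    have "0 \<le> tilted_length n w' v"
      using qb_dist_eq_tilted_length[OF w' v] by linarith
    then have "nat (tilted_length n w' v) < nat (tilted_length n w v)" using le by linarith
    from less.hyps[OF this mem'] have IH: "f (w' i) = f (v i)" .
    obtain a b where "w' = w \<circ> transpose a b" "a < b"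
      using edge by (auto simp: quantum_bruhat_graph_iff)
    then have "w' i = w i \<or> w' (i + 1) = w (i + 1) \<or> w' i = w (i + 1)"
      by (auto simp: transpose_def)
    then show ?thesis
      using IH same[OF mem'] same[OF less.prems] by metis
  qed simp
qed

lemma optimal_cut_pred:
  assumes u: "u permutes {1..n}" and v: "v permutes {1..n}" and i: "i \<in> {1..n-1}"
    and closed: "\<And>w. w \<in> tilted_interval n u v \<Longrightarrow> w \<circ> transpose i (i + 1) \<in> tilted_interval n u v"
    and p: "optimal_cut n u v (i - 1) p" "optimal_cut n u v i p"
    and q: "optimal_cut n u v i q"
  shows "optimal_cut n u v (i - 1) q"
proof -
  define f :: "nat \<Rightarrow> int" where "f x = of_bool (p \<le> x) - of_bool (q \<le> x)" for x
  have i': "1 \<le> i" "i \<le> n" "i - 1 \<le> n" using i by auto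
  have pq: "p \<in> {1..n}" "q \<in> {1..n}" using p q by (auto simp: optimal_cut_def)
  have eq: "tail_count y i p - tail_count x i p = tail_count y i q - tail_count x i q"
    if "optimal_cut n x y i p" "optimal_cut n x y i q" for x y
    using that pq unfolding optimal_cut_def by (meson antisym)
  \<comment> \<open>The cuts \<open>p\<close> and \<open>q\<close> tie on prefix \<open>i\<close>
    both for \<open>w\<close> and for its swap, where \<open>w (i + 1)\<close> replaces
    \<open>w i\<close>.\<close>
  have same: "f (w i) = f (w (i + 1))" if w: "w \<in> tilted_interval n u v" for w
  proof -
    let ?w = "w \<circ> transpose i (i + 1)"
    have "tail_count w i p - tail_count u i p = tail_count w i q - tail_count u i q"
      using tilted_interval_optimal_cut(1)[OF u v w i'(2)] p(2) q by (intro eq)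
    moreover have "tail_count ?w i p - tail_count u i p = tail_count ?w i q - tail_count u i q"
      using tilted_interval_optimal_cut(1)[OF u v closed[OF w] i'(2)] p(2) q by (intro eq)
    ultimately show ?thesis using i'(1) by (simp add: tail_count_transpose f_def)
  qed
  have "f (u i) = f (v i)"
    using tilted_interval_invariant[OF u v, of f i u] same self_mem_tilted_interval[OF u v] by blast
  moreover obtain k where k: "i = Suc k" using i'(1) by (cases i) auto
  \<comment> \<open>Removing the last entries, on which \<open>f\<close> agrees, keeps the
    tie.\<close>
  ultimately have "tail_count v k p - tail_count u k p = tail_count v k q - tail_count u k q"
    using eq[OF p(2) q] by (simp add: f_def)
  then show ?thesis
    using p(1) pq k unfolding optimal_cut_def by simp
qed

theorem theorem3p25:
  fixes n i :: nat and u v :: "nat \<Rightarrow> nat"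
  assumes "u permutes {1..n}" and "v permutes {1..n}" and "i \<in> {1..n-1}"
  defines "P1 \<equiv> \<exists>a \<in> {1..n} \<rightarrow>\<^sub>E {1..n}. tilted_le n a u v \<and> i \<in> Des n a v \<inter> Asc n a u"
  defines "P2 \<equiv> \<exists>a \<in> {1..n} \<rightarrow>\<^sub>E {1..n}. tilted_le n a u v \<and> a i = a (i + 1) \<and>
             u \<circ> transpose i (i + 1) \<in> tilted_interval n u v \<and>
             v \<circ> transpose i (i + 1) \<in> tilted_interval n u v"
  defines "P3 \<equiv> tilted_interval n u v = {w \<circ> transpose i (i + 1) | w. w \<in> tilted_interval n u v}"
  shows "(P1 \<longleftrightarrow> P2) \<and> (P2 \<longleftrightarrow> P3)"
proof -
  let ?s = "transpose i (i + 1)" and ?T = "tilted_interval n u v"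
  have i: "1 \<le> i" "i \<in> {1..n}" "i + 1 \<in> {1..n}" "1 \<le> n" using assms(3) by auto
  have invol: "(w \<circ> ?s) \<circ> ?s = w" for w :: "nat \<Rightarrow> nat"
    by (simp add: comp_assoc)
  have P3_iff: "P3 \<longleftrightarrow> (\<forall>w\<in>?T. w \<circ> ?s \<in> ?T)"
  proof
    assume closed: "\<forall>w\<in>?T. w \<circ> ?s \<in> ?T"
    then have "w \<in> {w \<circ> ?s | w. w \<in> ?T}" if "w \<in> ?T" for w
      using that invol[of w] by (auto intro!: exI[of _ "w \<circ> ?s"])
    then show P3 unfolding P3_def using closed by auto
  qed (auto simp: P3_def)
  have P1_P3: P3 if P1: P1
  proof -
    obtain a where a: "a \<in> {1..n} \<rightarrow>\<^sub>E {1..n}" "tilted_le n a u v" "i \<in> Des n a v \<inter> Asc n a u"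
      using P1 unfolding P1_def by blast
    have mem: "\<forall>k\<in>{1..n}. a k \<in> {1..n}" using a(1) by auto
    have opt: "\<And>k. k \<in> {1..n} \<Longrightarrow> optimal_cut n u v k (a k)"
      "\<And>k. k \<in> {1..n-1} \<Longrightarrow> optimal_cut n u v k (a (k + 1))"
      using a(2) tilted_le_iff_optimal_cut[OF assms(1,2) mem] by auto
    have ai: "a i = a (i + 1)" "rot_less (a i) (u i) (u (i + 1))" "rot_less (a i) (v (i + 1)) (v i)"
      using a(3) by (auto simp: Des_def Asc_def)
    \<comment> \<open>For \<open>i = 1\<close> the prefix is empty and any cut in range is
      optimal.\<close>
    have "optimal_cut n u v (i - 1) (a i)"
    proof (cases "i = 1")
      case True
      then show ?thesis using optimal_cut_0 mem i(2) by simp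
    next
      case False
      then have "i - 1 \<in> {1..n-1}" "i - 1 + 1 = i" using i by auto
      then show ?thesis using opt(2)[of "i - 1"] by simp
    qed
    moreover have "optimal_cut n u v (i + 1) (a i)" using opt(1)[OF i(3)] ai(1) by simp
    ultimately show P3
      unfolding P3_iff
      using tilted_interval_adjacent_transpose_closed[OF assms(1-3) _ opt(1)[OF i(2)] _ ai(2,3)] by blast
  qed
  have P2_P1: P1 if P2: P2
  proof -
    obtain a where a: "a \<in> {1..n} \<rightarrow>\<^sub>E {1..n}" "tilted_le n a u v" "a i = a (i + 1)"
      "u \<circ> ?s \<in> ?T" "v \<circ> ?s \<in> ?T"
      using P2 unfolding P2_def by blast
    have mem: "\<forall>k\<in>{1..n}. a k \<in> {1..n}" using a(1) by auto
    have opt: "optimal_cut n u v i (a i)"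
      using a(2) tilted_le_iff_optimal_cut[OF assms(1,2) mem] i by blast
    have "i \<in> Des n a v \<inter> Asc n a u"
      using rot_less_of_adjacent_transpose_right[OF assms(1-3) opt a(4)]
        rot_less_of_adjacent_transpose_left[OF assms(1-3) opt a(5)] a(3) assms(3)
      by (simp add: Des_def Asc_def)
    then show P1 unfolding P1_def using a(1,2) by blast
  qed
  have P3_P2: P2 if P3: P3
  proof -
    have closed: "w \<circ> ?s \<in> ?T" if "w \<in> ?T" for w using P3 that P3_iff by blast
    have "\<exists>r. optimal_cut n u v (k - 1) r \<and> optimal_cut n u v k r" if "1 \<le> k" for k
      using ex_common_optimal_cut[OF i(4), of u v "k - 1"] that by simp
    then obtain b where b: "optimal_cut n u v (k - 1) (b k)" "optimal_cut n u v k (b k)" if "1 \<le> k" for k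
      by metis
    \<comment> \<open>Using the cut \<open>b (i + 1)\<close> also at index \<open>i\<close> gives
      \<open>a i = a (i + 1)\<close>; \<open>optimal_cut_pred\<close> makes it valid on prefix
      \<open>i - 1\<close>.\<close>
    define q where "q = b (i + 1)"
    have q: "optimal_cut n u v i q" "optimal_cut n u v (i + 1) q"
      using b[of "i + 1"] by (auto simp: q_def)
    have q': "optimal_cut n u v (i - 1) q"
      using optimal_cut_pred[OF assms(1-3) closed b[OF i(1)] q(1)] .
    define a where "a = (\<lambda>k\<in>{1..n}. if k = i then q else b k)"
    have a_eq: "a k = (if k = i then q else b k)" if "k \<in> {1..n}" for k
      using that by (simp add: a_def)
    have a: "optimal_cut n u v (k - 1) (a k)" "optimal_cut n u v k (a k)" if "k \<in> {1..n}" for k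
      using that b[of k] q q' by (auto simp: a_eq)
    then have mem: "\<forall>k\<in>{1..n}. a k \<in> {1..n}"
      by (auto simp: optimal_cut_def)
    have "a \<in> {1..n} \<rightarrow>\<^sub>E {1..n}"
      using mem by (auto simp: a_def)
    moreover have "tilted_le n a u v"
      unfolding tilted_le_iff_optimal_cut[OF assms(1,2) mem]
    proof (intro conjI ballI)
      fix k assume "k \<in> {1..n-1}"
      then have "k + 1 \<in> {1..n}" by auto
      then show "optimal_cut n u v k (a (k + 1))" using a(1)[of "k + 1"] by simp
    qed (rule a(2))
    moreover have "a i = a (i + 1)" using i by (simp add: a_eq q_def)
    ultimately show P2
      unfolding P2_def using closed self_mem_tilted_interval[OF assms(1,2)] by blast
  qed
  show ?thesis using P1_P3 P2_P1 P3_P2 by blast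
qed

end
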